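(* Let $\alpha,\gamma$ be real numbers with $\gamma>0$, $\alpha\neq\gamma$ and $$\alpha\ge(2^{1/3}-1)^{1/4}\,\gamma .$$ Then for every positive integer $n$ divisible by $4$, the maximal value of the permanent on $\widehat{\Lambda}_n(\alpha,\gamma-\alpha,\gamma)$ is $$M_n(\alpha,\gamma-\alpha,\gamma)=\bigl(2(\alpha^4+\gamma^4)\bigr)^{n/4}.$$
   Context: For real $\alpha,\beta,\gamma$, $\Lambda_n(\alpha,\beta,\gamma)$ is the class of $n\times n$ matrices containing each of $\alpha,\beta,\gamma$ exactly once in each row and in each column, all other entries being $0$ (i.e. matrices $\alpha A+\beta B+\gamma C$ with $A,B,C$ permutation matrices with pairwise disjoint supports). $\widehat{\Lambda}_n(\alpha,\beta,\gamma)$ is the subclass of those matrices with $\beta$'s on the main diagonal and with symmetric positions of $\alpha$ and $\gamma$ ($\alpha$ is placed at $(i,j)$ if and only if $\gamma$ is placed at $(j,i)$); equivalently, the set of matrices $\alpha S^{-1}+\beta I_n+\gamma S$, where $S$ is the permutation matrix of a permutation of $\{1,\dots,n\}$ all of whose cycles have length at least $3$. $M_n(\alpha,\beta,\gamma)$ denotes the maximum of the permanent over $\widehat{\Lambda}_n(\alpha,\beta,\gamma)$. Here $\beta=\gamma-\alpha$. *)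

theory Defs
  imports Complex_Main "Jordan_Normal_Form.Matrix"
begin

text \<open>Modelled on the library definition of the determinant of a \<^typ>\<open>'a mat\<close>.\<close>

definition permanent :: "'a::comm_semiring_1 mat \<Rightarrow> 'a" where
  "permanent A = (if dim_row A = dim_col A
     then (\<Sum>p \<in> {p. p permutes {0..<dim_row A}}. \<Prod>i = 0..<dim_row A. A $$ (i, p i))
     else 0)"

definition perm_mat :: "nat \<Rightarrow> (nat \<Rightarrow> nat) \<Rightarrow> real mat" where
  "perm_mat n \<sigma> = mat n n (\<lambda>(i, j). if j = \<sigma> i then 1 else 0)"

definition perm_mats :: "nat \<Rightarrow> real mat set" where
  "perm_mats n = {perm_mat n \<sigma> | \<sigma>. \<sigma> permutes {0..<n}}"

definition disj_supp :: "nat \<Rightarrow> real mat \<Rightarrow> real mat \<Rightarrow> bool" where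
  "disj_supp n A B \<longleftrightarrow> (\<forall>i<n. \<forall>j<n. A $$ (i, j) = 0 \<or> B $$ (i, j) = 0)"

text \<open>The places of \<open>\<alpha>\<close>, \<open>\<beta>\<close>, \<open>\<gamma>\<close> are recorded by three permutation matrices rather than read
  off from the entries of the sum, so that the definitions also make sense when some of the
  three numbers coincide or vanish.\<close>

definition Lambda :: "nat \<Rightarrow> real \<Rightarrow> real \<Rightarrow> real \<Rightarrow> real mat set" where
  "Lambda n \<alpha> \<beta> \<gamma> = {\<alpha> \<cdot>\<^sub>m A + \<beta> \<cdot>\<^sub>m B + \<gamma> \<cdot>\<^sub>m C | A B C.
     A \<in> perm_mats n \<and> B \<in> perm_mats n \<and> C \<in> perm_mats n \<and>
     disj_supp n A B \<and> disj_supp n A C \<and> disj_supp n B C}"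

definition Lambda_hat :: "nat \<Rightarrow> real \<Rightarrow> real \<Rightarrow> real \<Rightarrow> real mat set" where
  "Lambda_hat n \<alpha> \<beta> \<gamma> = {\<alpha> \<cdot>\<^sub>m A + \<beta> \<cdot>\<^sub>m B + \<gamma> \<cdot>\<^sub>m C | A B C.
     A \<in> perm_mats n \<and> B \<in> perm_mats n \<and> C \<in> perm_mats n \<and>
     disj_supp n A B \<and> disj_supp n A C \<and> disj_supp n B C \<and>
     B = 1\<^sub>m n \<and> (\<forall>i<n. \<forall>j<n. A $$ (i, j) = 1 \<longleftrightarrow> C $$ (j, i) = 1)}"

definition max_permanent :: "nat \<Rightarrow> real \<Rightarrow> real \<Rightarrow> real \<Rightarrow> real" where
  "max_permanent n \<alpha> \<beta> \<gamma> = Max (permanent ` Lambda_hat n \<alpha> \<beta> \<gamma>)"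

lemma Lambda_hat_subset: "Lambda_hat n \<alpha> \<beta> \<gamma> \<subseteq> Lambda n \<alpha> \<beta> \<gamma>"
  unfolding Lambda_def Lambda_hat_def by blast

lemma finite_perm_mats: "finite (perm_mats n)"
  unfolding perm_mats_def by (simp add: finite_permutations)

lemma finite_Lambda_hat: "finite (Lambda_hat n \<alpha> \<beta> \<gamma>)"
proof (rule finite_subset)
  let ?P = "perm_mats n"
  show "Lambda_hat n \<alpha> \<beta> \<gamma> \<subseteq>
      (\<lambda>(A, B, C). \<alpha> \<cdot>\<^sub>m A + \<beta> \<cdot>\<^sub>m B + \<gamma> \<cdot>\<^sub>m C) ` (?P \<times> ?P \<times> ?P)"
    unfolding Lambda_hat_def by force
  show "finite ((\<lambda>(A, B, C). \<alpha> \<cdot>\<^sub>m A + \<beta> \<cdot>\<^sub>m B + \<gamma> \<cdot>\<^sub>m C) ` (?P \<times> ?P \<times> ?P))"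
    by (intro finite_imageI finite_cartesian_product finite_perm_mats)
qed

lemma perm_mat_index:
  "i < n \<Longrightarrow> j < n \<Longrightarrow> perm_mat n \<sigma> $$ (i, j) = (if j = \<sigma> i then 1 else 0)"
  by (simp add: perm_mat_def)

lemma one_mat_eq_perm_mat: "1\<^sub>m n = perm_mat n id"
  by (rule eq_matI) (auto simp: perm_mat_def)

text \<open>The conditions on \<open>\<sigma>\<close> below say that all its cycles have length at least 3.\<close>

lemma Lambda_hat_eq:
  "Lambda_hat n \<alpha> \<beta> \<gamma> =
     {\<alpha> \<cdot>\<^sub>m perm_mat n (inv_into UNIV \<sigma>) + \<beta> \<cdot>\<^sub>m 1\<^sub>m n + \<gamma> \<cdot>\<^sub>m perm_mat n \<sigma> | \<sigma>.
        \<sigma> permutes {0..<n} \<and> (\<forall>i<n. \<sigma> i \<noteq> i \<and> \<sigma> (\<sigma> i) \<noteq> i)}"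
  (is "?L = ?R")
proof
  show "?L \<subseteq> ?R"
  proof
    fix M assume "M \<in> ?L"
    then obtain A C where M: "M = \<alpha> \<cdot>\<^sub>m A + \<beta> \<cdot>\<^sub>m 1\<^sub>m n + \<gamma> \<cdot>\<^sub>m C"
      and AC: "A \<in> perm_mats n" "C \<in> perm_mats n"
      and d: "disj_supp n A C" "disj_supp n (1\<^sub>m n) C"
      and sym: "\<forall>i<n. \<forall>j<n. A $$ (i, j) = 1 \<longleftrightarrow> C $$ (j, i) = 1"
      unfolding Lambda_hat_def by blast
    from AC obtain \<tau> \<sigma> where A: "A = perm_mat n \<tau>" "\<tau> permutes {0..<n}"
      and C: "C = perm_mat n \<sigma>" "\<sigma> permutes {0..<n}"
      unfolding perm_mats_def by blast
    have lt: "\<sigma> i < n" "\<tau> i < n" if "i < n" for i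
      using permutes_in_image[OF A(2), of i] permutes_in_image[OF C(2), of i] that by auto
    have st: "\<sigma> (\<tau> i) = i" if "i < n" for i
      using sym[rule_format, OF that lt(2)[OF that]] that lt[OF that]
      by (auto simp: A C perm_mat_index split: if_splits)
    have "\<tau> i = inv_into UNIV \<sigma> i" if "i < n" for i
      using st[OF that] C(2) by (metis permutes_inv_eq)
    then have eqA: "A = perm_mat n (inv_into UNIV \<sigma>)"
      by (auto simp: A perm_mat_def intro!: eq_matI)
    have "\<sigma> i \<noteq> i" if "i < n" for i
      using d(2) that by (force simp: disj_supp_def C perm_mat_index)
    moreover have "\<sigma> (\<sigma> i) \<noteq> i" if "i < n" for i
    proof
      assume "\<sigma> (\<sigma> i) = i"
      then have "\<sigma> i = inv_into UNIV \<sigma> i" using C(2) by (metis permutes_inv_eq)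
      then show False
        using d(1)[unfolded disj_supp_def, rule_format, OF that lt(1)[OF that]] that lt(1)[OF that]
        by (simp add: C eqA perm_mat_index split: if_splits)
    qed
    ultimately show "M \<in> ?R" using M C eqA by blast
  qed
  show "?R \<subseteq> ?L"
  proof
    fix M assume "M \<in> ?R"
    then obtain \<sigma> where M: "M = \<alpha> \<cdot>\<^sub>m perm_mat n (inv_into UNIV \<sigma>) + \<beta> \<cdot>\<^sub>m 1\<^sub>m n + \<gamma> \<cdot>\<^sub>m perm_mat n \<sigma>"
      and p: "\<sigma> permutes {0..<n}" and c: "\<forall>i<n. \<sigma> i \<noteq> i \<and> \<sigma> (\<sigma> i) \<noteq> i" by blast
    have ie: "inv_into UNIV \<sigma> i = j \<longleftrightarrow> \<sigma> j = i" for i j using p by (metis permutes_inv_eq)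
    have "perm_mat n (inv_into UNIV \<sigma>) \<in> perm_mats n" "perm_mat n \<sigma> \<in> perm_mats n" "1\<^sub>m n \<in> perm_mats n"
      using p permutes_inv[OF p] permutes_id unfolding perm_mats_def one_mat_eq_perm_mat by blast+
    moreover have "disj_supp n (perm_mat n (inv_into UNIV \<sigma>)) (1\<^sub>m n)"
      unfolding disj_supp_def using c ie by (simp add: perm_mat_index) metis
    moreover have "disj_supp n (1\<^sub>m n) (perm_mat n \<sigma>)"
      unfolding disj_supp_def using c by (simp add: perm_mat_index) metis
    moreover have "disj_supp n (perm_mat n (inv_into UNIV \<sigma>)) (perm_mat n \<sigma>)"
    proof -
      have "inv_into UNIV \<sigma> i \<noteq> \<sigma> i" if "i < n" for i
        using c that ie by blast
      then show ?thesis unfolding disj_supp_def by (simp add: perm_mat_index) metis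
    qed
    moreover have "\<forall>i<n. \<forall>j<n. perm_mat n (inv_into UNIV \<sigma>) $$ (i, j) = 1 \<longleftrightarrow> perm_mat n \<sigma> $$ (j, i) = 1"
    proof (intro allI impI)
      fix i j assume "i < n" "j < n"
      moreover have "j = inv_into UNIV \<sigma> i \<longleftrightarrow> i = \<sigma> j" using ie[of i j] by metis
      ultimately show "perm_mat n (inv_into UNIV \<sigma>) $$ (i, j) = 1 \<longleftrightarrow> perm_mat n \<sigma> $$ (j, i) = 1"
        by (simp add: perm_mat_index)
    qed
    ultimately show "M \<in> ?L" unfolding M Lambda_hat_def by blast
  qed
qed

end

theory Submission
  imports Defs "HOL-Combinatorics.Combinatorics"
begin

text \<open>
  The permanent of \<open>\<alpha> S^(-1) + \<beta> I + \<gamma> S\<close> factors over the cycles of the permutation. On a cycle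
  of length \<open>r \<ge> 3\<close> the contributing permutations are the two rotations, of weight \<open>\<gamma>\<^sup>r\<close> and \<open>\<alpha>\<^sup>r\<close>,
  and the products of disjoint transpositions of neighbours. The latter form a continuant with
  characteristic equation \<open>x\<^sup>2 = \<beta> x + \<alpha>\<gamma>\<close>; since \<open>\<beta> = \<gamma> - \<alpha>\<close>, its roots are \<open>\<gamma>\<close> and \<open>-\<alpha>\<close>, so that the
  cycle contributes \<open>f(r) = 2\<gamma>\<^sup>r + \<alpha>\<^sup>r + (-\<alpha>)\<^sup>r\<close>. The bound \<open>f(r)\<^sup>4 \<le> f(4)\<^sup>r\<close> holds for all \<open>r \<ge> 4\<close>,
  and for \<open>r = 3\<close> it is exactly the hypothesis on \<open>\<alpha>/\<gamma>\<close>. Hence 4-cycles are optimal.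
\<close>

subsection \<open>Sums over permutations\<close>

text \<open>The permanent with rows and columns indexed by an arbitrary set, so that cycles and
  paths can be cut out without renumbering.\<close>

definition perm_sum :: "('a \<Rightarrow> 'a \<Rightarrow> 'b::comm_semiring_1) \<Rightarrow> 'a set \<Rightarrow> 'b" where
  "perm_sum w V = (\<Sum>p | p permutes V. \<Prod>i\<in>V. w i (p i))"

lemma perm_sum_empty [simp]: "perm_sum w {} = 1"
  by (simp add: perm_sum_def)

text \<open>The permutations of \<open>V\<close> agreeing with \<open>q\<close> on \<open>A\<close>
  are exactly the maps \<open>q \<circ> r\<close> with \<open>r\<close> permuting
  \<open>V - A\<close>, because undoing \<open>q\<close> fixes every point of \<open>A\<close>.
  Reindexing by \<open>r\<close> makes the factors over \<open>A\<close> constant.\<close>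

lemma sum_permutes_prescribed:
  assumes "finite V" "A \<subseteq> V" "q permutes A"
  shows "(\<Sum>p | p permutes V \<and> (\<forall>i\<in>A. p i = q i). \<Prod>i\<in>V. w i (p i)) =
    (\<Prod>i\<in>A. w i (q i)) * perm_sum w (V - A)"
proof -
  let ?R = "{r. r permutes (V - A)}"
  have qr: "q \<circ> r permutes V" "\<And>i. i \<in> A \<Longrightarrow> q (r i) = q i"
    "\<And>i. i \<in> V - A \<Longrightarrow> q (r i) = r i" if "r permutes (V - A)" for r
  proof -
    show "q \<circ> r permutes V"
      using that assms permutes_subset[of _ _ V] by (intro permutes_compose) auto
    show "q (r i) = q i" if "i \<in> A" for i
      using that \<open>r permutes _\<close> by (simp add: permutes_not_in)
    show "q (r i) = r i" if "i \<in> V - A" for i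
      using that \<open>r permutes _\<close> assms(3) by (metis Diff_iff permutes_in_image permutes_not_in)
  qed
  have inv_p: "inv_into UNIV q \<circ> p permutes (V - A)" if "p permutes V" "\<forall>i\<in>A. p i = q i" for p
  proof (rule permutes_superset)
    show "inv_into UNIV q \<circ> p permutes V"
      using that assms permutes_subset[OF permutes_inv[OF assms(3)]] by (intro permutes_compose) auto
    show "(inv_into UNIV q \<circ> p) x = x" if "x \<in> V - (V - A)" for x
      using that \<open>\<forall>i\<in>A. p i = q i\<close> assms(3) by (simp add: permutes_inverses)
  qed
  have "(\<Sum>p | p permutes V \<and> (\<forall>i\<in>A. p i = q i). \<Prod>i\<in>V. w i (p i)) =
      (\<Sum>r\<in>?R. \<Prod>i\<in>V. w i ((q \<circ> r) i))"
    by (rule sum.reindex_bij_witness[of _ "\<lambda>r. q \<circ> r" "\<lambda>p. inv_into UNIV q \<circ> p"])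
      (use qr inv_p assms(3) in \<open>auto simp: fun_eq_iff permutes_inverses\<close>)
  also have "\<dots> = (\<Sum>r\<in>?R. (\<Prod>i\<in>A. w i (q i)) * (\<Prod>i\<in>V - A. w i (r i)))"
  proof (rule sum.cong)
    fix r assume "r \<in> ?R"
    then have r: "r permutes (V - A)" by simp
    have "(\<Prod>i\<in>V. w i ((q \<circ> r) i)) = (\<Prod>i\<in>V - A. w i (q (r i))) * (\<Prod>i\<in>A. w i (q (r i)))"
      using prod.subset_diff[OF assms(2,1)] by simp
    also have "\<dots> = (\<Prod>i\<in>V - A. w i (r i)) * (\<Prod>i\<in>A. w i (q i))"
      using qr[OF r] by simp
    finally show "(\<Prod>i\<in>V. w i ((q \<circ> r) i)) = (\<Prod>i\<in>A. w i (q i)) * (\<Prod>i\<in>V - A. w i (r i))"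
      by (simp add: mult.commute)
  qed simp
  also have "\<dots> = (\<Prod>i\<in>A. w i (q i)) * perm_sum w (V - A)"
    by (simp add: perm_sum_def sum_distrib_left)
  finally show ?thesis .
qed

text \<open>Block triangular shape suffices. A nonzero term maps \<open>A\<close> injectively into
  itself, hence onto itself since \<open>A\<close> is finite. Grouping such terms by their
  restriction \<open>q\<close> to \<open>A\<close> yields the product.\<close>

lemma perm_sum_split:
  assumes "finite V" "A \<subseteq> V" and zero: "\<And>i j. i \<in> A \<Longrightarrow> j \<in> V - A \<Longrightarrow> w i j = 0"
  shows "perm_sum w V = perm_sum w A * perm_sum w (V - A)"
proof -
  let ?T = "\<lambda>q. {p. p permutes V \<and> (\<forall>i\<in>A. p i = q i)}"
  have finA: "finite A" using assms finite_subset by blast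
  have finT: "finite (?T q)" for q
    by (rule finite_subset[OF _ finite_permutations[OF assms(1)]]) auto
  have in_T: "\<exists>q. q permutes A \<and> p \<in> ?T q" if p: "p permutes V" and nz: "(\<Prod>i\<in>V. w i (p i)) \<noteq> 0" for p
  proof -
    have "w i (p i) \<noteq> 0" if "i \<in> V" for i
      using nz prod_zero[OF assms(1), of "\<lambda>i. w i (p i)"] that by auto
    then have "p i \<notin> V - A" if "i \<in> A" for i
      using zero[OF that] assms(2) that by blast
    moreover have "p i \<in> V" if "i \<in> A" for i
      using that assms(2) permutes_in_image[OF p, of i] by blast
    ultimately have "p ` A \<subseteq> A" by blast
    moreover have inj: "inj_on p A"
      using p by (meson inj_on_subset permutes_inj subset_UNIV)
    ultimately have "bij_betw p A A"
      using finA by (simp add: bij_betw_def endo_inj_surj)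
    then have "bij_betw (\<lambda>x. if x \<in> A then p x else x) A A"
      by (subst bij_betw_cong[of _ _ p]) auto
    then have "(\<lambda>x. if x \<in> A then p x else x) permutes A"
      by (rule bij_imp_permutes) auto
    then show ?thesis using p by (intro exI[of _ "\<lambda>x. if x \<in> A then p x else x"]) auto
  qed
  have "perm_sum w V = (\<Sum>p\<in>(\<Union>q\<in>{q. q permutes A}. ?T q). \<Prod>i\<in>V. w i (p i))"
    unfolding perm_sum_def
    by (rule sum.mono_neutral_right) (use assms(1) in_T in \<open>auto simp: finite_permutations\<close>)
  also have "\<dots> = (\<Sum>q | q permutes A. \<Sum>p\<in>?T q. \<Prod>i\<in>V. w i (p i))"
  proof (rule sum.UNION_disjoint)
    show "\<forall>q\<in>{q. q permutes A}. \<forall>q'\<in>{q. q permutes A}. q \<noteq> q' \<longrightarrow> ?T q \<inter> ?T q' = {}"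
    proof (intro ballI impI)
      fix q q' assume q: "q \<in> {q. q permutes A}" "q' \<in> {q. q permutes A}" "q \<noteq> q'"
      then obtain x where "q x \<noteq> q' x" by (auto simp: fun_eq_iff)
      then have "x \<in> A" using q by (metis mem_Collect_eq permutes_not_in)
      then show "?T q \<inter> ?T q' = {}" using \<open>q x \<noteq> q' x\<close> by auto
    qed
  qed (use finA finT in \<open>auto simp: finite_permutations\<close>)
  also have "\<dots> = (\<Sum>q | q permutes A. (\<Prod>i\<in>A. w i (q i)) * perm_sum w (V - A))"
    using assms by (intro sum.cong) (simp_all add: sum_permutes_prescribed)
  also have "\<dots> = perm_sum w A * perm_sum w (V - A)"
    by (simp add: perm_sum_def sum_distrib_right)
  finally show ?thesis .
qed

lemma sum_permutes_fixed:
  assumes "finite V" "a \<in> V"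
  shows "(\<Sum>p | p permutes V \<and> p a = a. \<Prod>i\<in>V. w i (p i)) = w a a * perm_sum w (V - {a})"
  using sum_permutes_prescribed[of V "{a}" id w] assms by (simp add: permutes_id)

lemma sum_permutes_swapped:
  assumes "finite V" "a \<in> V" "b \<in> V" "a \<noteq> b"
  shows "(\<Sum>p | p permutes V \<and> p a = b \<and> p b = a. \<Prod>i\<in>V. w i (p i)) =
    w a b * w b a * perm_sum w (V - {a, b})"
  using sum_permutes_prescribed[of V "{a, b}" "transpose a b" w] assms
  by (simp add: permutes_swap_id)

text \<open>In a nonzero term both the image and the preimage of \<open>a\<close> lie in
  \<open>{a, b}\<close>, so \<open>a\<close> is either fixed or swapped with \<open>b\<close>.
  Applied at the end of a path, this gives the recurrence of the continuants.\<close>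

lemma perm_sum_leaf:
  assumes "finite V" "a \<in> V" "b \<in> V" "a \<noteq> b"
    and row: "\<And>i. i \<in> V - {a, b} \<Longrightarrow> w a i = 0" and col: "\<And>i. i \<in> V - {a, b} \<Longrightarrow> w i a = 0"
  shows "perm_sum w V = w a a * perm_sum w (V - {a}) + w a b * w b a * perm_sum w (V - {a, b})"
proof -
  let ?A = "{p. p permutes V \<and> p a = a}" and ?B = "{p. p permutes V \<and> p a = b \<and> p b = a}"
  have fin: "finite ?A" "finite ?B"
    by (rule finite_subset[OF _ finite_permutations[OF assms(1)]]; auto)+
  have "p \<in> ?A \<union> ?B" if p: "p permutes V" and nz: "(\<Prod>i\<in>V. w i (p i)) \<noteq> 0" for p
  proof -
    have nz: "w i (p i) \<noteq> 0" if "i \<in> V" for i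
      using nz prod_zero[OF assms(1), of "\<lambda>i. w i (p i)"] that by auto
    have "p a \<in> V" using p assms(2) by (simp add: permutes_in_image)
    with row nz[OF assms(2)] have "p a \<in> {a, b}" by blast
    moreover obtain x where x: "x \<in> V" "p x = a"
      using permutes_image[OF p] assms(2) by (metis imageE)
    with col nz[OF x(1)] have "x \<in> {a, b}" by blast
    ultimately show ?thesis using x p assms(4) by auto
  qed
  then have "perm_sum w V = (\<Sum>p\<in>?A \<union> ?B. \<Prod>i\<in>V. w i (p i))"
    unfolding perm_sum_def
    by (intro sum.mono_neutral_right) (use assms(1) in \<open>auto simp: finite_permutations\<close>)
  also have "\<dots> = (\<Sum>p\<in>?A. \<Prod>i\<in>V. w i (p i)) + (\<Sum>p\<in>?B. \<Prod>i\<in>V. w i (p i))"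
    using fin assms(4) by (intro sum.union_disjoint) auto
  finally show ?thesis
    using assms by (simp add: sum_permutes_fixed sum_permutes_swapped)
qed

subsection \<open>Permanents of cycles\<close>

text \<open>The entry in row \<open>i\<close> and column \<open>j\<close> of the matrix. The test
  \<open>\<sigma> j = i\<close> places \<alpha> at the inverse image of \<open>i\<close> without
  mentioning an inverse function.\<close>

definition tri_weight :: "('a \<Rightarrow> 'a) \<Rightarrow> real \<Rightarrow> real \<Rightarrow> real \<Rightarrow> 'a \<Rightarrow> 'a \<Rightarrow> real" where
  "tri_weight \<sigma> \<alpha> \<beta> \<gamma> i j =
    (if \<sigma> j = i then \<alpha> else 0) + (if i = j then \<beta> else 0) + (if \<sigma> i = j then \<gamma> else 0)"

lemma tri_weight_nonzeroD:
  "tri_weight \<sigma> \<alpha> \<beta> \<gamma> i j \<noteq> 0 \<Longrightarrow> \<sigma> j = i \<or> i = j \<or> \<sigma> i = j"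
  by (auto simp: tri_weight_def split: if_splits)

section \<open>The orbit of a point on a cycle of length at least three\<close>

locale long_cycle =
  fixes \<sigma> :: "'a \<Rightarrow> 'a" and a :: 'a
  assumes perm: "permutation \<sigma>" and no_fix: "\<sigma> a \<noteq> a" and no_swap: "\<sigma> (\<sigma> a) \<noteq> a"
begin

abbreviation r where "r \<equiv> least_power \<sigma> a"
abbreviation c where "c i \<equiv> (\<sigma> ^^ i) a"
abbreviation cyc where "cyc \<equiv> c ` {0..<r}"

lemma inj_\<sigma>: "inj \<sigma>"
  using perm by (simp add: permutation bij_is_inj)

lemma \<sigma>_eq_iff [simp]: "\<sigma> x = \<sigma> y \<longleftrightarrow> x = y"
  using inj_\<sigma> by (simp add: inj_eq)

lemma r_ge_3: "r \<ge> 3"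
proof -
  have "(\<sigma> ^^ r) a = a" "r > 0"
    using perm by (rule least_power_of_permutation)+
  then have "r \<noteq> 1" "r \<noteq> 2"
    using no_fix no_swap by (auto simp: numeral_2_eq_2)
  with \<open>r > 0\<close> show ?thesis by linarith
qed

lemma c_r [simp]: "c r = a"
  using perm by (rule least_power_of_permutation)

lemma c_add_r [simp]: "c (i + r) = c i"
  by (simp add: funpow_add)

text \<open>Equal values force \<open>r\<close> to divide the difference of the indices, which is
  less than \<open>r\<close> inside a window of \<open>r\<close> consecutive indices. The free start
  \<open>s\<close> serves paths that begin anywhere on the cycle.\<close>

lemma c_eq_iff:
  assumes "i \<in> {s..<s + r}" "j \<in> {s..<s + r}"
  shows "c i = c j \<longleftrightarrow> i = j"
proof -
  have "i = j" if "i \<le> j" "i \<in> {s..<s + r}" "j \<in> {s..<s + r}" "c i = c j" for i j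
  proof -
    have "c (j - i) = a"
      using funpow_diff[OF inj_\<sigma> that(1,4)] .
    then have "r dvd j - i"
      by (rule least_power_minimal)
    then show ?thesis
      using that nat_dvd_not_less[of "j - i" r] by force
  qed
  from this[of i j] this[of j i] assms show ?thesis
    by (metis nat_le_linear)
qed

lemma c_in_cyc: "c i \<in> cyc"
proof (induction i)
  case 0
  show ?case using r_ge_3 by (intro image_eqI[of _ _ 0]) auto
next
  case (Suc i)
  then obtain j where j: "c i = c j" "j < r" by auto
  then have "c (Suc i) = c (Suc j)" by simp
  moreover have "c (Suc j) \<in> cyc"
  proof (cases "Suc j = r")
    case True
    then have "c (Suc j) = c 0" by (simp only: c_r) simp
    then show ?thesis using r_ge_3 by (intro image_eqI[of _ _ 0]) auto
  next
    case False
    then show ?thesis using j(2) by (intro image_eqI[of _ _ "Suc j"]) auto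
  qed
  ultimately show ?case by simp
qed

lemma \<sigma>_c: "\<sigma> (c i) = c (Suc i)"
  by simp

lemma \<sigma>_in_cyc: "x \<in> cyc \<Longrightarrow> \<sigma> x \<in> cyc"
  by (erule imageE) (simp only: \<sigma>_c c_in_cyc)

text \<open>The locale excludes short cycles at \<open>a\<close> only. Since r is at least 3, the
  window starting at \<open>i\<close> contains the indices i, i+1 and i+2, which carries the
  exclusion to all points of the orbit, here and in \<open>no_swap_cyc\<close>.\<close>

lemma no_fix_cyc:
  assumes "x \<in> cyc"
  shows "\<sigma> x \<noteq> x"
proof -
  obtain i where "x = c i" using assms by blast
  then show ?thesis using c_eq_iff[of "Suc i" i i] r_ge_3 by simp
qed

lemma no_swap_cyc:
  assumes "x \<in> cyc"
  shows "\<sigma> (\<sigma> x) \<noteq> x"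
proof -
  obtain i where "x = c i" using assms by blast
  then show ?thesis using c_eq_iff[of "Suc (Suc i)" i i] r_ge_3 by simp
qed

lemma finite_cyc: "finite cyc"
  by simp

lemma card_cyc: "card cyc = r"
proof -
  have "inj_on c {0..<r}" using c_eq_iff[of _ 0] by (auto intro: inj_onI)
  then show ?thesis by (simp add: card_image)
qed

lemma image_\<sigma>_cyc: "\<sigma> ` cyc = cyc"
proof (rule endo_inj_surj)
  show "\<sigma> ` cyc \<subseteq> cyc" using \<sigma>_in_cyc by blast
  show "inj_on \<sigma> cyc" using inj_\<sigma> by (rule inj_on_subset) simp
qed (rule finite_cyc)

text \<open>Expanding at the last vertex gives P(k+2) = (\<gamma> - \<alpha>) P(k+1) +
  \<alpha>\<gamma> P(k), whose characteristic roots are \<gamma> and -\<alpha>. The factor \<alpha>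
  + \<gamma> clears the denominator of the closed form. The bound \<open>k < r\<close> leaves out a
  vertex of the cycle, so the path does not close up.\<close>

lemma perm_sum_path:
  assumes "k < r"
  shows "(\<alpha> + \<gamma>) * perm_sum (tri_weight \<sigma> \<alpha> (\<gamma> - \<alpha>) \<gamma>) (c ` {s..<s + k}) = \<gamma> ^ Suc k - (- \<alpha>) ^ Suc k"
  using assms
proof (induction k rule: induct_nat_012)
  case 0
  show ?case by simp
next
  case 1
  have "\<sigma> (c s) \<noteq> c s" using no_fix_cyc c_in_cyc by blast
  then show ?case
    by (simp add: perm_sum_def tri_weight_def power2_eq_square algebra_simps)
next
  case (ge2 k)
  let ?w = "tri_weight \<sigma> \<alpha> (\<gamma> - \<alpha>) \<gamma>"
  let ?V = "c ` {s..<s + Suc (Suc k)}"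
  let ?a = "c (Suc (s + k))" and ?b = "c (s + k)"
  \<comment> \<open>The range goes one index past the path, because the successor of the last vertex
    must also differ from every vertex on it.\<close>
  have eq: "c i = c j \<longleftrightarrow> i = j" if "s \<le> i" "s \<le> j" "i \<le> Suc (Suc (s + k))" "j \<le> Suc (Suc (s + k))" for i j
    using ge2(3) that by (intro c_eq_iff[of _ s]) auto
  have V: "?V = insert ?a (insert ?b (c ` {s..<s + k}))"
    by (simp add: atLeastLessThanSuc)
  have nin: "?a \<notin> c ` {s..<s + k}" "?b \<notin> c ` {s..<s + k}" "?a \<noteq> ?b"
    by (auto simp: eq simp del: funpow.simps)
  have w: "?w (c i) (c j) = (if Suc j = i then \<alpha> else 0) + (if i = j then \<gamma> - \<alpha> else 0) + (if Suc i = j then \<gamma> else 0)"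
    if "i \<in> {s..<s + Suc (Suc k)}" "j \<in> {s..<s + Suc (Suc k)}" for i j
    using that unfolding tri_weight_def \<sigma>_c by (simp add: eq del: funpow.simps)
  have "perm_sum ?w ?V = ?w ?a ?a * perm_sum ?w (?V - {?a}) + ?w ?a ?b * ?w ?b ?a * perm_sum ?w (?V - {?a, ?b})"
  proof (rule perm_sum_leaf)
    fix x assume "x \<in> ?V - {?a, ?b}"
    then obtain j where j: "x = c j" "s \<le> j" "j < s + k" using V by auto
    show "?w ?a x = 0" "?w x ?a = 0"
      using w[of "Suc (s + k)" j] w[of j "Suc (s + k)"] j by auto
  qed (use V nin in auto)
  also have "?V - {?a} = c ` {s..<s + Suc k}"
    using V nin by (auto simp: atLeastLessThanSuc)
  also have "?V - {?a, ?b} = c ` {s..<s + k}"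
    using V nin by auto
  also have "?w ?a ?a = \<gamma> - \<alpha>"
    using w[of "Suc (s + k)" "Suc (s + k)"] by auto
  also have "?w ?a ?b = \<alpha>"
    using w[of "Suc (s + k)" "s + k"] by auto
  also have "?w ?b ?a = \<gamma>"
    using w[of "s + k" "Suc (s + k)"] by auto
  finally have step: "perm_sum ?w ?V = (\<gamma> - \<alpha>) * perm_sum ?w (c ` {s..<s + Suc k}) +
      \<alpha> * \<gamma> * perm_sum ?w (c ` {s..<s + k})" .
  have "(\<alpha> + \<gamma>) * perm_sum ?w ?V =
      (\<gamma> - \<alpha>) * ((\<alpha> + \<gamma>) * perm_sum ?w (c ` {s..<s + Suc k})) +
      \<alpha> * \<gamma> * ((\<alpha> + \<gamma>) * perm_sum ?w (c ` {s..<s + k}))"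
    unfolding step by (simp add: algebra_simps)
  also have "\<dots> = \<gamma> ^ Suc (Suc (Suc k)) - (- \<alpha>) ^ Suc (Suc (Suc k))"
    unfolding ge2.IH(2)[OF Suc_lessD[OF ge2.prems]] ge2.IH(1)[OF Suc_lessD[OF Suc_lessD[OF ge2.prems]]]
    by (simp add: algebra_simps)
  finally show ?case .
qed

section \<open>Nonzero terms on a full cycle\<close>

definition rot where "rot x = (if x \<in> cyc then \<sigma> x else x)"

lemma rot_permutes: "rot permutes cyc"
proof (rule bij_imp_permutes)
  have "bij_betw \<sigma> cyc cyc"
    using image_\<sigma>_cyc inj_\<sigma> by (auto simp: bij_betw_def intro: inj_on_subset)
  then show "bij_betw rot cyc cyc"
    by (subst bij_betw_cong[of _ _ \<sigma>]) (auto simp: rot_def)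
qed (simp add: rot_def)

text \<open>Two consecutive forward moves force the next one: if \<open>p\<close> takes x to
  \<sigma> x and \<sigma> x to \<sigma> (\<sigma> x), both of these images are taken, so \<sigma>
  (\<sigma> x) can neither step back nor stay. Starting with the moves into and out of
  \<open>a\<close>, this runs round the whole cycle.\<close>

lemma eq_rot:
  assumes p: "p permutes cyc" and adj: "\<And>x. x \<in> cyc \<Longrightarrow> \<sigma> (p x) = x \<or> x = p x \<or> \<sigma> x = p x"
    and pa: "p a = \<sigma> a" and pd: "p (c (r - 1)) = a"
  shows "p = rot"
proof -
  \<comment> \<open>Adding \<open>r - 1\<close> stands for the predecessor index k - 1 modulo
    \<open>r\<close>, avoiding subtraction at k = 0.\<close>
  have *: "p (c (k + (r - 1))) = c (k + r) \<and> p (c (k + r)) = c (Suc k + r)" for k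
  proof (induction k)
    case 0
    then show ?case using pa pd by simp
  next
    case (Suc k)
    define x where "x = c (k + (r - 1))"
    have "Suc (k + (r - 1)) = k + r" using r_ge_3 by simp
    then have \<sigma>x: "\<sigma> x = c (k + r)" by (metis x_def funpow.simps(2) o_apply)
    then have \<sigma>\<sigma>x: "\<sigma> (\<sigma> x) = c (Suc k + r)" by simp
    have px: "p x = \<sigma> x" "p (\<sigma> x) = \<sigma> (\<sigma> x)"
      using Suc.IH \<sigma>x \<sigma>\<sigma>x x_def by simp_all
    have x: "x \<in> cyc" "\<sigma> (\<sigma> x) \<in> cyc"
      using c_in_cyc \<sigma>_in_cyc x_def by blast+
    have inj_p: "u = v" if "p u = p v" for u v
      using that permutes_inj[OF p] by (simp add: inj_eq)
    have "\<sigma> (p (\<sigma> (\<sigma> x))) \<noteq> \<sigma> (\<sigma> x)" "p (\<sigma> (\<sigma> x)) \<noteq> \<sigma> (\<sigma> x)"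
      using px inj_p[of "\<sigma> (\<sigma> x)" x] inj_p[of "\<sigma> (\<sigma> x)" "\<sigma> x"] no_fix_cyc[OF x(1)] no_swap_cyc[OF x(1)]
      by auto
    then have "p (\<sigma> (\<sigma> x)) = \<sigma> (\<sigma> (\<sigma> x))" using adj[OF x(2)] by auto
    moreover have "Suc k + (r - 1) = k + r" using r_ge_3 by simp
    ultimately show ?case using px(2) \<sigma>x \<sigma>\<sigma>x by simp
  qed
  show ?thesis
  proof
    fix x
    show "p x = rot x"
    proof (cases "x \<in> cyc")
      case True
      then obtain j where "x = c j" by auto
      then show ?thesis using *[of j] True by (simp add: rot_def)
    qed (use p in \<open>simp add: rot_def permutes_not_in\<close>)
  qed
qed

text \<open>Let b and d be the successor and the predecessor of \<open>a\<close>. A nonzero term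
  fixes \<open>a\<close>, swaps it with b, swaps it with d, or passes through \<open>a\<close> in
  one direction; in the last case it is \<open>rot\<close> or its inverse. The first three cases
  leave paths with r-1, r-2 and r-2 vertices.\<close>

lemma perm_sum_cycle:
  assumes "\<alpha> + \<gamma> \<noteq> 0"
  shows "perm_sum (tri_weight \<sigma> \<alpha> (\<gamma> - \<alpha>) \<gamma>) cyc = 2 * \<gamma> ^ r + \<alpha> ^ r + (- \<alpha>) ^ r"
proof -
  let ?w = "tri_weight \<sigma> \<alpha> (\<gamma> - \<alpha>) \<gamma>"
  define b where "b = \<sigma> a"
  define d where "d = c (r - 1)"
  have \<sigma>d: "\<sigma> d = a"
    using r_ge_3 c_r by (metis d_def Suc_diff_1 funpow.simps(2) o_apply numeral_3_eq_3 zero_less_Suc less_le_trans)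
  have in_cyc: "a \<in> cyc" "b \<in> cyc" "d \<in> cyc"
    using c_in_cyc[of 0] c_in_cyc[of 1] c_in_cyc[of "r - 1"] by (simp_all add: b_def d_def)
  have dist: "a \<noteq> b" "a \<noteq> d" "b \<noteq> d"
    using no_fix no_swap \<sigma>d b_def by auto
  let ?inv = "inv_into UNIV rot"
  let ?A = "{p. p permutes cyc \<and> p a = a}"
  let ?B = "{p. p permutes cyc \<and> p a = b \<and> p b = a}"
  let ?D = "{p. p permutes cyc \<and> p a = d \<and> p d = a}"
  let ?f = "\<lambda>p. \<Prod>i\<in>cyc. ?w i (p i)"
  have fin: "finite ?A" "finite ?B" "finite ?D"
    by (rule finite_subset[OF _ finite_permutations[OF finite_cyc]]; auto)+
  \<comment> \<open>The inequality \<open>rot b \<noteq> a\<close> keeps the rotation out of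
    \<open>?B\<close>; likewise \<open>?inv d \<noteq> a\<close> below keeps its inverse out of
    \<open>?D\<close>.\<close>
  have rot_a: "rot a = b" "rot d = a" "rot b \<noteq> a"
    using in_cyc \<sigma>d no_swap by (auto simp: rot_def b_def)
  have inv_a: "?inv b = a" "?inv a = d" "?inv d \<noteq> a"
    using rot_a dist permutes_inv_eq[OF rot_permutes] by auto
  have inv_perm: "?inv permutes cyc"
    using rot_permutes by (rule permutes_inv)
  have cover: "p \<in> ?A \<union> ?B \<union> ?D \<union> {rot} \<union> {?inv}" if p: "p permutes cyc" and nz: "?f p \<noteq> 0" for p
  proof -
    have nz: "?w i (p i) \<noteq> 0" if "i \<in> cyc" for i
      using nz prod_zero[OF finite_cyc, of "\<lambda>i. ?w i (p i)"] that by auto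
    have adj: "\<sigma> (p x) = x \<or> x = p x \<or> \<sigma> x = p x" if "x \<in> cyc" for x
      using tri_weight_nonzeroD[OF nz[OF that]] .
    have d_iff: "\<sigma> x = a \<longleftrightarrow> x = d" for x
      using \<sigma>d \<sigma>_eq_iff by metis
    obtain x where x: "x \<in> cyc" "p x = a"
      using permutes_image[OF p] in_cyc(1) by (metis imageE)
    have "x = a \<or> x = b \<or> x = d"
      using adj[OF x(1)] d_iff[of x] unfolding x(2) b_def by blast
    moreover have "p a = a \<or> p a = b \<or> p a = d"
      using adj[OF in_cyc(1)] d_iff[of "p a"] unfolding b_def by metis
    moreover have "p = rot" if "p a = b" "p d = a"
      using p adj that unfolding b_def d_def by (rule eq_rot)
    moreover have "p = ?inv" if "p a = d" "p b = a"
    proof -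
      \<comment> \<open>Adjacency is symmetric under inversion, so the backward case reduces to the
        forward one.\<close>
      have "inv_into UNIV p = rot"
      proof (rule eq_rot)
        show "inv_into UNIV p permutes cyc" using p by (rule permutes_inv)
        then have "inv_into UNIV p x \<in> cyc" if "x \<in> cyc" for x
          using that by (simp add: permutes_in_image)
        then show "\<sigma> (inv_into UNIV p x) = x \<or> x = inv_into UNIV p x \<or> \<sigma> x = inv_into UNIV p x" if "x \<in> cyc" for x
          using adj[of "inv_into UNIV p x"] that permutes_inverses(1)[OF p] by metis
        show "inv_into UNIV p a = \<sigma> a" "inv_into UNIV p (c (r - 1)) = a"
          using that permutes_inv_eq[OF p] by (simp_all add: b_def d_def)
      qed
      then show ?thesis using permutes_inv_inv[OF p] by simp
    qed
    ultimately show ?thesis using p x(2) dist by auto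
  qed
  have "perm_sum ?w cyc = (\<Sum>p\<in>?A \<union> ?B \<union> ?D \<union> {rot} \<union> {?inv}. ?f p)"
    unfolding perm_sum_def
  proof (rule sum.mono_neutral_right)
    show "finite {p. p permutes cyc}" using finite_cyc by (rule finite_permutations)
    show "?A \<union> ?B \<union> ?D \<union> {rot} \<union> {?inv} \<subseteq> {p. p permutes cyc}"
      using rot_permutes inv_perm by auto
    show "\<forall>p\<in>{p. p permutes cyc} - (?A \<union> ?B \<union> ?D \<union> {rot} \<union> {?inv}). ?f p = 0"
      using cover by blast
  qed
  also have "\<dots> = sum ?f ?A + sum ?f ?B + sum ?f ?D + sum ?f {rot} + sum ?f {?inv}"
  proof -
    have "?inv \<noteq> rot"
      using inv_a rot_a dist by metis
    then have 1: "(?A \<union> ?B \<union> ?D \<union> {rot}) \<inter> {?inv} = {}"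
      using inv_a dist by simp
    have 2: "(?A \<union> ?B \<union> ?D) \<inter> {rot} = {}"
      using rot_a dist by simp
    have 3: "(?A \<union> ?B) \<inter> ?D = {}" and 4: "?A \<inter> ?B = {}"
      using dist by auto
    show ?thesis
      using fin by (simp only: sum.union_disjoint[OF _ _ 1] sum.union_disjoint[OF _ _ 2]
          sum.union_disjoint[OF _ _ 3] sum.union_disjoint[OF _ _ 4] finite_Un finite.emptyI finite_insert)
  qed
  also have "sum ?f ?A = (\<gamma> - \<alpha>) * perm_sum ?w (cyc - {a})"
    using sum_permutes_fixed[OF finite_cyc in_cyc(1), of ?w] no_fix by (simp add: tri_weight_def)
  also have "sum ?f ?B = \<alpha> * \<gamma> * perm_sum ?w (cyc - {a, b})"
    using sum_permutes_swapped[OF finite_cyc in_cyc(1,2) dist(1), of ?w] no_fix no_swap dist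
    by (simp add: tri_weight_def b_def)
  also have "sum ?f ?D = \<alpha> * \<gamma> * perm_sum ?w (cyc - {a, d})"
  proof -
    have "\<sigma> a \<noteq> d" using dist by (simp add: b_def)
    then show ?thesis
      using sum_permutes_swapped[OF finite_cyc in_cyc(1,3) dist(2), of ?w] \<sigma>d dist
      by (simp add: tri_weight_def)
  qed
  also have "sum ?f {rot} = \<gamma> ^ r"
  proof -
    have "?w i (rot i) = \<gamma>" if "i \<in> cyc" for i
      using no_fix_cyc[OF that] no_swap_cyc[OF that] that by (auto simp: tri_weight_def rot_def)
    then have "?f rot = (\<Prod>i\<in>cyc. \<gamma>)" by (intro prod.cong) auto
    then show ?thesis by (simp only: prod_constant card_cyc) simp
  qed
  also have "sum ?f {?inv} = \<alpha> ^ r"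
  proof -
    have "?w i (?inv i) = \<alpha>" if i: "i \<in> cyc" for i
    proof -
      let ?j = "?inv i"
      have j: "?j \<in> cyc" using i inv_perm by (simp only: permutes_in_image)
      have "rot ?j = i" using permutes_inverses(1)[OF rot_permutes] .
      then have "\<sigma> ?j = i" using j by (simp add: rot_def)
      then show ?thesis
        using no_fix_cyc[OF j] no_swap_cyc[OF j] by (auto simp: tri_weight_def)
    qed
    then have "?f ?inv = (\<Prod>i\<in>cyc. \<alpha>)" by (intro prod.cong) auto
    then show ?thesis by (simp only: prod_constant card_cyc) simp
  qed
  finally have total: "perm_sum ?w cyc = (\<gamma> - \<alpha>) * perm_sum ?w (cyc - {a})
    + \<alpha> * \<gamma> * perm_sum ?w (cyc - {a, b}) + \<alpha> * \<gamma> * perm_sum ?w (cyc - {a, d}) + \<gamma> ^ r + \<alpha> ^ r" .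
  \<comment> \<open>The path obtained by deleting \<open>a\<close> has k+1 vertices; deleting
    \<open>a\<close> and one neighbour leaves k.\<close>
  obtain k where k: "r = Suc (Suc k)"
    using that[of "r - 2"] r_ge_3 by simp
  have eq: "c i = c j \<longleftrightarrow> i = j" if "i < r" "j < r" for i j
    using that by (intro c_eq_iff[of _ 0]) auto
  have sets: "{0..<r} - {0} = {1..<1 + Suc k}" "{0..<r} - {0, 1} = {2..<2 + k}" "{0..<r} - {0, r - 1} = {1..<1 + k}"
    using k by auto
  have diff: "cyc - c ` I = c ` ({0..<r} - I)" if "I \<subseteq> {0..<r}" for I
    by (rule inj_on_image_set_diff[symmetric, of _ "{0..<r}"]) (use that eq in \<open>auto intro: inj_onI\<close>)
  have "cyc - {a} = c ` {1..<1 + Suc k}" "cyc - {a, b} = c ` {2..<2 + k}" "cyc - {a, d} = c ` {1..<1 + k}"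
    using diff[of "{0}"] diff[of "{0, 1}"] diff[of "{0, r - 1}"] k unfolding sets
    by (simp_all add: b_def d_def)
  then have parts: "(\<alpha> + \<gamma>) * perm_sum ?w (cyc - {a}) = \<gamma> ^ Suc (Suc k) - (- \<alpha>) ^ Suc (Suc k)"
    "(\<alpha> + \<gamma>) * perm_sum ?w (cyc - {a, b}) = \<gamma> ^ Suc k - (- \<alpha>) ^ Suc k"
    "(\<alpha> + \<gamma>) * perm_sum ?w (cyc - {a, d}) = \<gamma> ^ Suc k - (- \<alpha>) ^ Suc k"
    using k by (simp_all only: perm_sum_path lessI less_SucI)
  have "(\<alpha> + \<gamma>) * perm_sum ?w cyc = (\<gamma> - \<alpha>) * ((\<alpha> + \<gamma>) * perm_sum ?w (cyc - {a}))
    + \<alpha> * \<gamma> * ((\<alpha> + \<gamma>) * perm_sum ?w (cyc - {a, b}))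
    + \<alpha> * \<gamma> * ((\<alpha> + \<gamma>) * perm_sum ?w (cyc - {a, d})) + (\<alpha> + \<gamma>) * (\<gamma> ^ r + \<alpha> ^ r)"
    unfolding total by (simp only: algebra_simps)
  \<comment> \<open>With x = \<gamma> and y = -\<alpha>, the three path terms add up to (x - y)(x^r
    + y^r); the two rotations supply the remaining \<gamma>^r + \<alpha>^r.\<close>
  also have "\<dots> = (\<alpha> + \<gamma>) * (2 * \<gamma> ^ r + \<alpha> ^ r + (- \<alpha>) ^ r)"
    unfolding parts unfolding k by (simp add: algebra_simps)
  finally show ?thesis
    using assms by (simp only: mult_cancel_left) simp
qed

text \<open>Injectivity of \<sigma> keeps points outside the orbit outside, so no nonzero entry
  links the orbit to the rest and \<open>perm_sum_split\<close> applies.\<close>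

lemma perm_sum_cycle_split:
  assumes "\<alpha> + \<gamma> \<noteq> 0" "finite V" "\<sigma> ` V \<subseteq> V" "a \<in> V"
  shows "cyc \<subseteq> V" "\<sigma> ` (V - cyc) \<subseteq> V - cyc"
    "perm_sum (tri_weight \<sigma> \<alpha> (\<gamma> - \<alpha>) \<gamma>) V =
      (2 * \<gamma> ^ r + \<alpha> ^ r + (- \<alpha>) ^ r) * perm_sum (tri_weight \<sigma> \<alpha> (\<gamma> - \<alpha>) \<gamma>) (V - cyc)"
proof -
  have "c i \<in> V" for i
    by (induction i) (use assms in auto)
  then show sub: "cyc \<subseteq> V" by blast
  have out: "\<sigma> x \<notin> cyc" if "x \<notin> cyc" for x
    using that inj_image_mem_iff[OF inj_\<sigma>, of x cyc] unfolding image_\<sigma>_cyc by simp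
  show "\<sigma> ` (V - cyc) \<subseteq> V - cyc"
  proof (rule image_subsetI)
    fix x assume "x \<in> V - cyc"
    then show "\<sigma> x \<in> V - cyc" using out[of x] assms(3) by (simp only: Diff_iff image_subset_iff) simp
  qed
  have zero: "tri_weight \<sigma> \<alpha> (\<gamma> - \<alpha>) \<gamma> i j = 0" if "i \<in> cyc" "j \<in> V - cyc" for i j
  proof -
    have "\<sigma> j \<notin> cyc" "i \<noteq> j" "\<sigma> i \<in> cyc" "j \<notin> cyc"
      using that out[of j] \<sigma>_in_cyc[of i] by blast+
    then have "\<sigma> j \<noteq> i" "i \<noteq> j" "\<sigma> i \<noteq> j"
      using that(1) by metis+
    then show ?thesis by (simp add: tri_weight_def)
  qed
  show "perm_sum (tri_weight \<sigma> \<alpha> (\<gamma> - \<alpha>) \<gamma>) V =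
      (2 * \<gamma> ^ r + \<alpha> ^ r + (- \<alpha>) ^ r) * perm_sum (tri_weight \<sigma> \<alpha> (\<gamma> - \<alpha>) \<gamma>) (V - cyc)"
    using perm_sum_split[where w = "tri_weight \<sigma> \<alpha> (\<gamma> - \<alpha>) \<gamma>", OF assms(2) sub zero]
    unfolding perm_sum_cycle[OF assms(1)] .
qed

end

subsection \<open>Optimality of 4-cycles\<close>

text \<open>This is the decrease of the s-norm from the 2-norm of (x, y), with the roots
  cleared.\<close>

lemma sum_powers_le:
  fixes x y :: real
  assumes "x \<ge> 0" "y \<ge> 0" "s \<ge> 2"
  shows "(x ^ s + y ^ s)\<^sup>2 \<le> (x\<^sup>2 + y\<^sup>2) ^ s"
  using assms(3)
proof (induction s rule: dec_induct)
  case base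
  show ?case by simp
next
  case (step s)
  \<comment> \<open>Lagrange's identity, with the cross terms of the expanded square collected in
    the last summand.\<close>
  have "(x ^ Suc s + y ^ Suc s)\<^sup>2 = (x\<^sup>2 + y\<^sup>2) * (x ^ s + y ^ s)\<^sup>2
      - ((x * y ^ s - y * x ^ s)\<^sup>2 + 2 * (x\<^sup>2 + y\<^sup>2) * x ^ s * y ^ s)"
    by (simp add: power2_eq_square algebra_simps)
  also have "\<dots> \<le> (x\<^sup>2 + y\<^sup>2) * (x ^ s + y ^ s)\<^sup>2 - 0"
    using assms by (intro diff_left_mono add_nonneg_nonneg mult_nonneg_nonneg) auto
  also have "\<dots> \<le> (x\<^sup>2 + y\<^sup>2) * (x\<^sup>2 + y\<^sup>2) ^ s"
    using step.IH by (simp add: mult_left_mono)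
  finally show ?case by simp
qed

text \<open>For r = 2s the left base is 2(\<alpha>^(2s) + \<gamma>^(2s)), and
  \<open>sum_powers_le\<close> is applied to the squares of \<alpha> and \<gamma>. For odd r the
  powers of \<alpha> cancel, leaving 16 \<gamma>^(4r): from r = 5 on, 16 is at most 2^r, while r = 3
  is the third assumption multiplied by 8.\<close>

lemma cycle_bound:
  fixes \<alpha> \<gamma> :: real
  assumes "\<gamma> > 0" "\<alpha> > 0" "2 * \<gamma> ^ 12 \<le> (\<alpha> ^ 4 + \<gamma> ^ 4) ^ 3" "r \<ge> 3"
  shows "(2 * \<gamma> ^ r + \<alpha> ^ r + (- \<alpha>) ^ r) ^ 4 \<le> (2 * (\<alpha> ^ 4 + \<gamma> ^ 4)) ^ r"
proof (cases "even r")
  case True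
  then obtain s where s: "r = 2 * s" by blast
  with assms(4) have "s \<ge> 2" by simp
  have "2 * \<gamma> ^ r + \<alpha> ^ r + (- \<alpha>) ^ r = 2 * ((\<alpha>\<^sup>2) ^ s + (\<gamma>\<^sup>2) ^ s)"
    using True s by (simp flip: power_mult)
  then have "(2 * \<gamma> ^ r + \<alpha> ^ r + (- \<alpha>) ^ r) ^ 4 = 2 ^ 4 * (((\<alpha>\<^sup>2) ^ s + (\<gamma>\<^sup>2) ^ s)\<^sup>2)\<^sup>2"
    by (simp only: power_mult_distrib flip: power_mult) simp
  also have "\<dots> \<le> 2 ^ r * (((\<alpha>\<^sup>2)\<^sup>2 + (\<gamma>\<^sup>2)\<^sup>2) ^ s)\<^sup>2"
    using \<open>s \<ge> 2\<close> s assms by (intro mult_mono power_mono sum_powers_le power_increasing) auto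
  also have "\<dots> = (2 * (\<alpha> ^ 4 + \<gamma> ^ 4)) ^ r"
    unfolding power_mult_distrib by (simp add: s mult.commute flip: power_mult)
  finally show ?thesis .
next
  case False
  then have lhs: "(2 * \<gamma> ^ r + \<alpha> ^ r + (- \<alpha>) ^ r) ^ 4 = 2 ^ 4 * (\<gamma> ^ 4) ^ r"
    by (simp add: power_mult_distrib mult.commute flip: power_mult)
  show ?thesis
  proof (cases "r = 3")
    case True
    show ?thesis unfolding lhs unfolding True power_mult_distrib using assms(3) by simp
  next
    case False
    have "2 ^ 4 * (\<gamma> ^ 4) ^ r \<le> 2 ^ r * (\<alpha> ^ 4 + \<gamma> ^ 4) ^ r"
      using False assms by (intro mult_mono power_mono power_increasing) auto
    then show ?thesis unfolding lhs power_mult_distrib .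
  qed
qed

section \<open>Multiplying over the cycles\<close>

lemma perm_sum_induct_step:
  fixes \<alpha> \<gamma> :: real
  assumes "\<alpha> + \<gamma> \<noteq> 0" "permutation \<sigma>" "finite V" "\<sigma> ` V \<subseteq> V" "a \<in> V" "\<sigma> a \<noteq> a" "\<sigma> (\<sigma> a) \<noteq> a"
  obtains W r where "W \<subset> V" "\<sigma> ` W \<subseteq> W" "r \<ge> 3" "r = least_power \<sigma> a" "card V = r + card W"
    "perm_sum (tri_weight \<sigma> \<alpha> (\<gamma> - \<alpha>) \<gamma>) V =
      (2 * \<gamma> ^ r + \<alpha> ^ r + (- \<alpha>) ^ r) * perm_sum (tri_weight \<sigma> \<alpha> (\<gamma> - \<alpha>) \<gamma>) W"
proof -
  interpret long_cycle \<sigma> a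
    using assms by unfold_locales
  note split = perm_sum_cycle_split[OF assms(1,3-5)]
  have "card V = r + card (V - cyc)"
    using card_Diff_subset[OF finite_cyc split(1)] card_mono[OF assms(3) split(1)] by (simp only: card_cyc)
  moreover have "V - cyc \<subset> V"
    using c_in_cyc[of 0] assms(5) by auto
  ultimately show ?thesis
    using that[OF _ split(2) r_ge_3 refl _ split(3)] by blast
qed

text \<open>Both claims are multiplicative: splitting off one cycle multiplies the sum by a
  nonnegative factor obeying \<open>cycle_bound\<close>, and the cycle lengths add up to
  \<open>card V\<close>.\<close>

lemma perm_sum_tri_weight_bound:
  fixes \<alpha> \<gamma> :: real
  assumes "\<gamma> > 0" "\<alpha> > 0" "2 * \<gamma> ^ 12 \<le> (\<alpha> ^ 4 + \<gamma> ^ 4) ^ 3" "permutation \<sigma>"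
    and "finite V" "\<sigma> ` V \<subseteq> V" "\<forall>x\<in>V. \<sigma> x \<noteq> x \<and> \<sigma> (\<sigma> x) \<noteq> x"
  defines "w \<equiv> tri_weight \<sigma> \<alpha> (\<gamma> - \<alpha>) \<gamma>"
  shows "0 \<le> perm_sum w V \<and> perm_sum w V ^ 4 \<le> (2 * (\<alpha> ^ 4 + \<gamma> ^ 4)) ^ card V"
  using assms(5-7)
proof (induction V rule: finite_psubset_induct)
  case (psubset V)
  show ?case
  proof (cases "V = {}")
    case True
    then show ?thesis by simp
  next
    case False
    then obtain a where a: "a \<in> V" by blast
    have "\<alpha> + \<gamma> \<noteq> 0" using assms by simp
    then obtain W r where W: "W \<subset> V" "\<sigma> ` W \<subseteq> W" "r \<ge> 3" "card V = r + card W"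
      and eq: "perm_sum w V = (2 * \<gamma> ^ r + \<alpha> ^ r + (- \<alpha>) ^ r) * perm_sum w W"
      using perm_sum_induct_step[of \<alpha> \<gamma> \<sigma> V a] assms(4) a psubset.hyps psubset.prems unfolding w_def by metis
    have IH: "0 \<le> perm_sum w W" "perm_sum w W ^ 4 \<le> (2 * (\<alpha> ^ 4 + \<gamma> ^ 4)) ^ card W"
      using psubset.IH[OF W(1,2)] psubset.prems(2) W(1) by blast+
    have "2 * \<gamma> ^ r + \<alpha> ^ r + (- \<alpha>) ^ r \<ge> 0"
      using assms(1,2) by (cases "even r") simp_all
    moreover have "perm_sum w V ^ 4 \<le> (2 * (\<alpha> ^ 4 + \<gamma> ^ 4)) ^ r * (2 * (\<alpha> ^ 4 + \<gamma> ^ 4)) ^ card W"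
      unfolding eq power_mult_distrib[of _ "perm_sum w W"]
      using cycle_bound[OF assms(1-3) W(3)] IH by (intro mult_mono) auto
    ultimately show ?thesis
      using IH(1) unfolding W(4) power_add by (simp add: eq)
  qed
qed

text \<open>Every cycle has length exactly 4 and contributes 2\<gamma>^4 + 2\<alpha>^4.\<close>

lemma perm_sum_tri_weight_4_cycles:
  fixes \<alpha> \<gamma> :: real
  assumes "\<alpha> + \<gamma> \<noteq> 0" "permutation \<sigma>" and four: "\<forall>x. (\<sigma> ^^ 4) x = x"
    and "finite V" "\<sigma> ` V \<subseteq> V" "\<forall>x\<in>V. \<sigma> x \<noteq> x \<and> \<sigma> (\<sigma> x) \<noteq> x"
  shows "perm_sum (tri_weight \<sigma> \<alpha> (\<gamma> - \<alpha>) \<gamma>) V = (2 * (\<alpha> ^ 4 + \<gamma> ^ 4)) ^ (card V div 4)"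
  using assms(4-6)
proof (induction V rule: finite_psubset_induct)
  case (psubset V)
  show ?case
  proof (cases "V = {}")
    case True
    then show ?thesis by simp
  next
    case False
    then obtain a where a: "a \<in> V" by blast
    obtain W r where W: "W \<subset> V" "\<sigma> ` W \<subseteq> W" "r \<ge> 3" "r = least_power \<sigma> a" "card V = r + card W"
      and eq: "perm_sum (tri_weight \<sigma> \<alpha> (\<gamma> - \<alpha>) \<gamma>) V =
        (2 * \<gamma> ^ r + \<alpha> ^ r + (- \<alpha>) ^ r) * perm_sum (tri_weight \<sigma> \<alpha> (\<gamma> - \<alpha>) \<gamma>) W"
      using perm_sum_induct_step[of \<alpha> \<gamma> \<sigma> V a] assms(1,2) a psubset.hyps psubset.prems by metis
    \<comment> \<open>Here the identification of r with the orbit length of \<open>a\<close> is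
      needed: being at least 3 and dividing 4, it equals 4.\<close>
    have dvd: "r dvd 4"
      unfolding W(4) using four by (intro least_power_minimal) blast
    then have "r \<le> 4" by (rule dvd_imp_le) simp
    moreover have "r \<noteq> 3" using dvd by auto
    ultimately have "r = 4" using W(3) by linarith
    then have "card V div 4 = Suc (card W div 4)" using W(5) by simp
    moreover have "\<forall>x\<in>W. \<sigma> x \<noteq> x \<and> \<sigma> (\<sigma> x) \<noteq> x"
      using psubset.prems(2) W(1) by blast
    ultimately show ?thesis
      using psubset.IH[OF W(1,2)] \<open>r = 4\<close> by (simp add: eq)
  qed
qed

section \<open>From matrices to sums over permutations, and the extremal permutation\<close>

lemma permanent_Lambda_hat:
  assumes "\<sigma> permutes {0..<n}"
  shows "permanent (\<alpha> \<cdot>\<^sub>m perm_mat n (inv_into UNIV \<sigma>) + \<beta> \<cdot>\<^sub>m 1\<^sub>m n + \<gamma> \<cdot>\<^sub>m perm_mat n \<sigma>) =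
    perm_sum (tri_weight \<sigma> \<alpha> \<beta> \<gamma>) {0..<n}" (is "permanent ?M = _")
proof -
  have dims: "dim_row ?M = n" "dim_col ?M = n"
    by (simp_all add: perm_mat_def)
  have entry: "?M $$ (i, j) = tri_weight \<sigma> \<alpha> \<beta> \<gamma> i j" if "i < n" "j < n" for i j
  proof -
    have "j = inv_into UNIV \<sigma> i \<longleftrightarrow> \<sigma> j = i" using assms by (metis permutes_inv_eq)
    then show ?thesis using that by (simp add: perm_mat_def tri_weight_def eq_commute[of j])
  qed
  show ?thesis
    unfolding permanent_def perm_sum_def dims if_P[OF refl]
  proof (intro sum.cong prod.cong refl)
    fix p i assume "p \<in> {p. p permutes {0..<n}}" and i: "i \<in> {0..<n}"
    then have "p i \<in> {0..<n}" using permutes_in_image[of p] by blast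
    then show "?M $$ (i, p i) = tri_weight \<sigma> \<alpha> \<beta> \<gamma> i (p i)"
      using i entry by simp
  qed
qed

lemma four_cycles_exist:
  fixes n :: nat
  assumes "4 dvd n"
  obtains \<sigma> where "\<sigma> permutes {0..<n}" "\<forall>i<n. \<sigma> i \<noteq> i \<and> \<sigma> (\<sigma> i) \<noteq> i" "\<forall>x. (\<sigma> ^^ 4) x = x"
proof -
  from assms obtain m where m: "n = 4 * m" by blast
  \<comment> \<open>Each block 4q, ..., 4q+3 is rotated by one step, with 4q+3 wrapping back to 4q.
    As 4 divides n, no block is cut off.\<close>
  define \<sigma> where "\<sigma> i = (if n \<le> i then i else if i mod 4 = 3 then i - 3 else i + 1)" for i
  have \<sigma>_div_mod: "\<sigma> (4 * q + t) = 4 * q + (t + 1) mod 4" if "q < m" "t < 4" for q t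
  proof -
    have "(n \<le> 4 * q + t) = False" "(4 * q + t) mod 4 = t"
      using that by (auto simp: m)
    then have "\<sigma> (4 * q + t) = (if t = 3 then 4 * q + t - 3 else 4 * q + t + 1)"
      by (simp only: \<sigma>_def if_False)
    then show ?thesis using that(2) by (cases "t = 3") simp_all
  qed
  have out: "\<sigma> i = i" if "n \<le> i" for i
    using that by (simp add: \<sigma>_def)
  have decomp: "\<exists>q t. i = 4 * q + t \<and> q < m \<and> t < 4" if "i < n" for i
    using that by (intro exI[of _ "i div 4"] exI[of _ "i mod 4"]) (auto simp: m)
  have long: "\<sigma> i \<noteq> i \<and> \<sigma> (\<sigma> i) \<noteq> i \<and> \<sigma> (\<sigma> (\<sigma> (\<sigma> i))) = i" if i_less: "i < n" for i
  proof -
    obtain q t where i: "i = 4 * q + t" "q < m" "t < 4" using decomp[OF i_less] by blast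
    from i(3) consider "t = 0" | "t = 1" | "t = 2" | "t = 3" by linarith
    moreover have "\<sigma> (4 * q) = 4 * q + 1" "\<sigma> (4 * q + 1) = 4 * q + 2"
      "\<sigma> (4 * q + 2) = 4 * q + 3" "\<sigma> (4 * q + 3) = 4 * q"
      using \<sigma>_div_mod[OF i(2), of 0] \<sigma>_div_mod[OF i(2), of 1]
        \<sigma>_div_mod[OF i(2), of 2] \<sigma>_div_mod[OF i(2), of 3] by simp_all
    ultimately show ?thesis unfolding i(1) by cases simp_all
  qed
  have four: "\<sigma> (\<sigma> (\<sigma> (\<sigma> i))) = i" for i
    using long[of i] out[of i] by (cases "i < n") auto
  have "\<sigma> permutes {0..<n}"
    \<comment> \<open>Since the fourth iterate is the identity, the third iterate provides the
      unique preimages.\<close>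
    unfolding permutes_def using out four by (auto, metis+)
  moreover have "\<forall>x. (\<sigma> ^^ 4) x = x"
    using four by (simp add: eval_nat_numeral)
  ultimately show ?thesis using that long by blast
qed

theorem theorem6:
  fixes \<alpha> \<gamma> :: real and n :: nat
  assumes "\<gamma> > 0"
    and "\<alpha> \<noteq> \<gamma>"
    and "\<alpha> \<ge> root 4 (root 3 2 - 1) * \<gamma>"
    and "n > 0"
    and "4 dvd n"
  shows "max_permanent n \<alpha> (\<gamma> - \<alpha>) \<gamma> = (2 * (\<alpha> ^ 4 + \<gamma> ^ 4)) ^ (n div 4)"
proof -
  let ?D = "2 * (\<alpha> ^ 4 + \<gamma> ^ 4)"
  have c: "root 3 2 - 1 > (0::real)" by simp
  then have "root 4 (root 3 2 - 1) * \<gamma> > 0" using assms(1) by simp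
  with assms(3) have \<alpha>: "\<alpha> > 0" by linarith
  \<comment> \<open>The fourth power removes the outer root; after adding \<gamma>^4 to both sides,
    cubing removes the inner one and gives the assumption of \<open>cycle_bound\<close>.\<close>
  have "(root 4 (root 3 2 - 1) * \<gamma>) ^ 4 \<le> \<alpha> ^ 4"
    using assms(1,3) c by (intro power_mono) auto
  then have "(root 3 2 - 1) * \<gamma> ^ 4 \<le> \<alpha> ^ 4"
    using c by (simp add: power_mult_distrib)
  then have "root 3 2 * \<gamma> ^ 4 \<le> \<alpha> ^ 4 + \<gamma> ^ 4" by (simp add: algebra_simps)
  then have "(root 3 2 * \<gamma> ^ 4) ^ 3 \<le> (\<alpha> ^ 4 + \<gamma> ^ 4) ^ 3"
    using assms(1) by (intro power_mono) auto
  then have cond: "2 * \<gamma> ^ 12 \<le> (\<alpha> ^ 4 + \<gamma> ^ 4) ^ 3"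
    by (simp add: power_mult_distrib)
  have perm: "permutation \<sigma>" and img: "\<sigma> ` {0..<n} \<subseteq> {0..<n}" if "\<sigma> permutes {0..<n}" for \<sigma>
    using that permutes_image[OF that] by (auto simp: permutation_permutes)
  have upper: "x \<le> ?D ^ (n div 4)" if "x \<in> permanent ` Lambda_hat n \<alpha> (\<gamma> - \<alpha>) \<gamma>" for x
  proof -
    from that obtain \<sigma> where \<sigma>: "\<sigma> permutes {0..<n}" "\<forall>i<n. \<sigma> i \<noteq> i \<and> \<sigma> (\<sigma> i) \<noteq> i"
      and x: "x = perm_sum (tri_weight \<sigma> \<alpha> (\<gamma> - \<alpha>) \<gamma>) {0..<n}"
      unfolding Lambda_hat_eq using permanent_Lambda_hat by auto
    have "x ^ 4 \<le> ?D ^ n"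
      unfolding x using perm_sum_tri_weight_bound[OF assms(1) \<alpha> cond perm[OF \<sigma>(1)] _ img[OF \<sigma>(1)]] \<sigma>(2) by simp
    \<comment> \<open>Divisibility by 4 turns the bound into a comparison of two fourth powers, from
      which the bases can be compared.\<close>
    also have "?D ^ n = (?D ^ (n div 4)) ^ 4"
      using assms(5) by (simp only: flip: power_mult) simp
    finally show ?thesis
      using \<alpha> assms(1) by (auto intro: power_le_imp_le_base[of _ 3])
  qed
  have attained: "?D ^ (n div 4) \<in> permanent ` Lambda_hat n \<alpha> (\<gamma> - \<alpha>) \<gamma>"
  proof -
    obtain \<sigma> where \<sigma>: "\<sigma> permutes {0..<n}" "\<forall>i<n. \<sigma> i \<noteq> i \<and> \<sigma> (\<sigma> i) \<noteq> i" "\<forall>x. (\<sigma> ^^ 4) x = x"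
      using four_cycles_exist[OF assms(5)] .
    have "?D ^ (n div 4) = perm_sum (tri_weight \<sigma> \<alpha> (\<gamma> - \<alpha>) \<gamma>) {0..<n}"
      using perm_sum_tri_weight_4_cycles[OF _ perm[OF \<sigma>(1)] \<sigma>(3) _ img[OF \<sigma>(1)], of \<alpha> \<gamma>] \<sigma>(2) \<alpha> assms(1) by simp
    also have "\<dots> = permanent (\<alpha> \<cdot>\<^sub>m perm_mat n (inv_into UNIV \<sigma>) + (\<gamma> - \<alpha>) \<cdot>\<^sub>m 1\<^sub>m n + \<gamma> \<cdot>\<^sub>m perm_mat n \<sigma>)"
      using permanent_Lambda_hat[OF \<sigma>(1)] by simp
    finally show ?thesis
      unfolding Lambda_hat_eq using \<sigma>(1,2) by blast
  qed
  show ?thesis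
    unfolding max_permanent_def
    using finite_Lambda_hat upper attained by (intro Max_eqI) auto
qed

end
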